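(* Let $X$ be a real Banach space with a normalized Schauder basis $(e_n)_{n\in\mathbb N}$ and let $w=(w_n)$ be a weight sequence. Then the following assertions are equivalent: (a) $(e_n)$ is $w$-reverse partially greedy. (b) $(e_n)$ is quasi-greedy and $w$-reverse conservative.
   Context: Let $(e_n^* )$ be the biorthogonal functionals of $(e_n)$. A weight sequence $w=(w_n)_{n\in\mathbb N}$ is a sequence of positive real numbers; $w(A)=\sum_{i\in A}w_i$ for $A\subset\mathbb N$. $\mathbb N^{<\infty}$ is the set of all finite subsets of $\mathbb N$ (including $\emptyset$). $1_A=\sum_{i\in A}e_i$ and $P_A(x)=\sum_{i\in A}e_i^*(x)e_i$ for $A\in\mathbb N^{<\infty}$. $A<B$ means that every element of $A$ is smaller than every element of $B$ (so it holds if $A$ or $B$ is empty); for $n\in\mathbb N$, $n<A$ means $\{n\}<A$. For $x\in X$ and $m\in\mathbb N$, $\Lambda_m(x)$ denotes any set of $m$ indices with $\min_{n\in\Lambda_m(x)}|e_n^*(x)|\ge\max_{n\notin\Lambda_m(x)}|e_n^*(x)|$; the corresponding $m$-th greedy approximant is $G_m(x)=\sum_{n\in\Lambda_m(x)}e_n^*(x)e_n$, and $\beta_m(x)=\max\Lambda_m(x)$. Conditions involving $G_m(x)$ are required for every admissible choice of $\Lambda_m(x)$. $(e_n)$ is quasi-greedy if there is a constant $C$ such that $\|G_m(x)\|\le C\|x\|$ for all $x\in X$, $m\in\mathbb N$. $(e_n)$ is $w$-reverse partially greedy if there is a constant $C$ such that for all $x\in X$, $m\in\mathbb N$, $$\|x-G_m(x)\|\le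 C\inf\{\|x-P_A(x)\|: A\in\mathbb N^{<\infty},\ w(A)\le w(\Lambda_m(x)),\ \beta_m(x)<A\}.$$ $(e_n)$ is $w$-reverse conservative if there is a constant $C\ge1$ such that $\|1_A\|\le C\|1_B\|$ whenever $A,B\in\mathbb N^{<\infty}$, $B<A$ and $w(A)\le w(B)$. *)

theory Defs
  imports "HOL-Analysis.Analysis"
begin

text \<open>
  The index set is the type \<open>nat\<close>, so bases and weights are indexed from 0.
\<close>

definition schauder_basis :: "(nat \<Rightarrow> 'a::banach) \<Rightarrow> bool" where
  "schauder_basis e \<longleftrightarrow> (\<forall>x. \<exists>!a. (\<lambda>n. a n *\<^sub>R e n) sums x)"

definition normalized :: "(nat \<Rightarrow> 'a::real_normed_vector) \<Rightarrow> bool" where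
  "normalized e \<longleftrightarrow> (\<forall>n. norm (e n) = 1)"

text \<open>
  \<open>coord e n\<close> is the biorthogonal functional $e_n^*$; it is meaningful only if \<open>e\<close> is a
  Schauder basis.
\<close>

definition coord :: "(nat \<Rightarrow> 'a::banach) \<Rightarrow> nat \<Rightarrow> 'a \<Rightarrow> real" where
  "coord e n x = (THE a. (\<lambda>k. a k *\<^sub>R e k) sums x) n"

lemma coord_sums:
  assumes "schauder_basis e"
  shows "(\<lambda>n. coord e n x *\<^sub>R e n) sums x"
  using assms theI'[of "\<lambda>a. (\<lambda>k. a k *\<^sub>R e k) sums x"]
  unfolding schauder_basis_def coord_def by blast

lemma coord_unique:
  assumes "schauder_basis e" and "(\<lambda>n. a n *\<^sub>R e n) sums x"
  shows "coord e n x = a n"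
  using assms coord_sums[OF assms(1), of x] unfolding schauder_basis_def by metis

lemma coord_basis:
  assumes "schauder_basis e"
  shows "coord e n (e m) = (if n = m then 1 else 0)"
proof -
  have "(\<lambda>k. (if k = m then 1 else 0) *\<^sub>R e k) sums e m"
    using sums_single[of m e] by (simp add: if_distrib[of "\<lambda>c. c *\<^sub>R _"] cong: if_cong)
  then show ?thesis
    by (rule coord_unique[OF assms])
qed

definition weight_of :: "(nat \<Rightarrow> real) \<Rightarrow> nat set \<Rightarrow> real" where
  "weight_of w A = (\<Sum>i\<in>A. w i)"

definition ind_sum :: "(nat \<Rightarrow> 'a::real_vector) \<Rightarrow> nat set \<Rightarrow> 'a" where
  "ind_sum e A = (\<Sum>i\<in>A. e i)"

definition proj :: "(nat \<Rightarrow> 'a::banach) \<Rightarrow> nat set \<Rightarrow> 'a \<Rightarrow> 'a" where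
  "proj e A x = (\<Sum>i\<in>A. coord e i x *\<^sub>R e i)"

definition set_less :: "nat set \<Rightarrow> nat set \<Rightarrow> bool" where
  "set_less A B \<longleftrightarrow> (\<forall>a\<in>A. \<forall>b\<in>B. a < b)"

text \<open>
  \<open>greedy_set e x m L\<close> says that \<open>L\<close> is an admissible choice of $\Lambda_m(x)$; the
  corresponding greedy approximant $G_m(x)$ is \<open>proj e L x\<close>, and $\beta_m(x)$ is \<open>Max L\<close>.
\<close>

definition greedy_set :: "(nat \<Rightarrow> 'a::banach) \<Rightarrow> 'a \<Rightarrow> nat \<Rightarrow> nat set \<Rightarrow> bool" where
  "greedy_set e x m L \<longleftrightarrow> finite L \<and> card L = m \<and>
     (\<forall>n\<in>L. \<forall>k. k \<notin> L \<longrightarrow> \<bar>coord e n x\<bar> \<ge> \<bar>coord e k x\<bar>)"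

definition quasi_greedy :: "(nat \<Rightarrow> 'a::banach) \<Rightarrow> bool" where
  "quasi_greedy e \<longleftrightarrow>
     (\<exists>C. \<forall>x m L. m \<ge> 1 \<longrightarrow> greedy_set e x m L \<longrightarrow> norm (proj e L x) \<le> C * norm x)"

text \<open>
  The infimum below is over a nonempty set (it contains the value for \<open>A = {}\<close>) that is
  bounded below by 0, and \<open>m \<ge> 1\<close> makes \<open>Max L\<close> meaningful.
\<close>

definition reverse_partially_greedy :: "(nat \<Rightarrow> real) \<Rightarrow> (nat \<Rightarrow> 'a::banach) \<Rightarrow> bool" where
  "reverse_partially_greedy w e \<longleftrightarrow>
     (\<exists>C. \<forall>x m L. m \<ge> 1 \<longrightarrow> greedy_set e x m L \<longrightarrow>
        norm (x - proj e L x) \<le>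
          C * (INF A\<in>{A. finite A \<and> weight_of w A \<le> weight_of w L \<and> set_less {Max L} A}.
                 norm (x - proj e A x)))"

definition reverse_conservative ::
    "(nat \<Rightarrow> real) \<Rightarrow> (nat \<Rightarrow> 'a::real_normed_vector) \<Rightarrow> bool" where
  "reverse_conservative w e \<longleftrightarrow>
     (\<exists>C\<ge>1. \<forall>A B. finite A \<longrightarrow> finite B \<longrightarrow> set_less B A \<longrightarrow> weight_of w A \<le> weight_of w B \<longrightarrow>
        norm (ind_sum e A) \<le> C * norm (ind_sum e B))"

end

theory Submission
  imports Defs
begin

text \<open>
  If the basis is $w$-reverse partially greedy, then $A=\emptyset$ gives quasi-greediness, and
  $x=1_A+1_B$ with greedy set $B$ gives $w$-reverse conservativity.

  Conversely, let $\Lambda$ be a greedy set of $x$, let $\Lambda<A$ with $w(A)\le w(\Lambda)$, and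
  put $y=x-P_A(x)$ and $t=\min_\Lambda|e_n^*(x)|$. Then $\Lambda$ is also a greedy set of $y$ and
  $x-P_\Lambda(x)=(y-P_\Lambda(y))+P_A(x)$. The coefficients of $P_A(x)$ are at most $t$ in modulus,
  so by convexity and conservativity $\|P_A(x)\|$ is controlled by $t\|1_\Lambda\|$, which
  quasi-greediness bounds by a multiple of $\|P_\Lambda(y)\|$ and hence of $\|y\|$.
\<close>

section \<open>Layer-cake estimates for finite sums with bounded coefficients\<close>

text \<open>
  By the layer-cake formula, $\sum_i b_iv_i=\int_0^M\sum_{b_i\ge s}v_i\,ds$.
\<close>

lemma norm_sum_scaleR_layer_le:
  fixes v :: "'i \<Rightarrow> 'a::banach"
  assumes L: "finite L" and b: "\<And>i. i \<in> L \<Longrightarrow> 0 \<le> b i \<and> b i \<le> M"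
    and M: "0 \<le> M" and K: "\<And>s. norm (\<Sum>i\<in>{i\<in>L. s \<le> b i}. v i) \<le> K"
  shows "norm (\<Sum>i\<in>L. b i *\<^sub>R v i) \<le> M * K"
proof -
  have "((\<lambda>s. if s \<in> {0..b i} then v i else 0) has_integral b i *\<^sub>R v i) {0..M}" if "i \<in> L" for i
  proof -
    have "((\<lambda>s. v i) has_integral b i *\<^sub>R v i) {0..b i}"
      using has_integral_const_real[of "v i" 0 "b i"] b[OF that] by simp
    then show ?thesis
      using has_integral_restrict[of "{0..b i}" "{0..M}" "\<lambda>s. v i"] b[OF that] by auto
  qed
  then have int: "((\<lambda>s. \<Sum>i\<in>L. if s \<in> {0..b i} then v i else 0) has_integral
      (\<Sum>i\<in>L. b i *\<^sub>R v i)) {0..M}"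
    by (intro has_integral_sum L)
  have "norm (\<Sum>i\<in>L. if s \<in> {0..b i} then v i else 0) \<le> K" if "s \<in> {0..M}" for s
  proof -
    have "(\<Sum>i\<in>L. if s \<in> {0..b i} then v i else 0) = (\<Sum>i\<in>{i\<in>L. s \<le> b i}. v i)"
      using that L by (simp add: sum.inter_filter)
    then show ?thesis using K by simp
  qed
  moreover have "0 \<le> K"
    using order_trans[OF norm_ge_zero K] by blast
  ultimately have "norm (\<Sum>i\<in>L. b i *\<^sub>R v i) \<le> K * measure lborel {0..M}"
    using has_integral_bound_real[OF _ _ int, of K "{}"] by simp
  then show ?thesis using M by (simp add: mult.commute)
qed

text \<open>Split the coefficients into positive and negative parts. Both take values in [0,t] and
  their level sets are subsets of \<open>A\<close>, so the layer-cake bound applies twice; this is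
  the factor 2.\<close>

lemma norm_sum_scaleR_subset_le:
  fixes v :: "'i \<Rightarrow> 'a::banach"
  assumes A: "finite A" and a: "\<And>i. i \<in> A \<Longrightarrow> \<bar>a i\<bar> \<le> t" and t: "0 \<le> t"
    and K: "\<And>B. B \<subseteq> A \<Longrightarrow> norm (sum v B) \<le> K"
  shows "norm (\<Sum>i\<in>A. a i *\<^sub>R v i) \<le> 2 * t * K"
proof -
  have pos: "norm (\<Sum>i\<in>A. max (a i) 0 *\<^sub>R v i) \<le> t * K"
    using a t by (intro norm_sum_scaleR_layer_le A K) fastforce+
  have neg: "norm (\<Sum>i\<in>A. max (- a i) 0 *\<^sub>R v i) \<le> t * K"
    using a t by (intro norm_sum_scaleR_layer_le A K) fastforce+
  have "(\<Sum>i\<in>A. a i *\<^sub>R v i) = (\<Sum>i\<in>A. max (a i) 0 *\<^sub>R v i) - (\<Sum>i\<in>A. max (- a i) 0 *\<^sub>R v i)"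
    unfolding sum_subtractf[symmetric] scaleR_diff_left[symmetric]
    by (intro sum.cong) (auto simp: max_def)
  then show ?thesis
    using norm_triangle_ineq4[of "\<Sum>i\<in>A. max (a i) 0 *\<^sub>R v i" "\<Sum>i\<in>A. max (- a i) 0 *\<^sub>R v i"] pos neg
    by simp
qed

section \<open>Coordinates, projections and the quasi-greedy constant\<close>

lemma coord_sum:
  assumes "schauder_basis e" "finite A"
  shows "coord e n (\<Sum>i\<in>A. a i *\<^sub>R e i) = (if n \<in> A then a n else 0)"
proof (rule coord_unique[OF assms(1)])
  show "(\<lambda>n. (if n \<in> A then a n else 0) *\<^sub>R e n) sums (\<Sum>i\<in>A. a i *\<^sub>R e i)"
    using sums_If_finite_set[OF assms(2), of "\<lambda>i. a i *\<^sub>R e i"]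
    by (simp add: if_distrib[of "\<lambda>c. c *\<^sub>R _"] cong: if_cong)
qed

lemma coord_diff:
  assumes "schauder_basis e"
  shows "coord e n (x - y) = coord e n x - coord e n y"
  using sums_diff[OF coord_sums[OF assms, of x] coord_sums[OF assms, of y]]
  by (intro coord_unique[OF assms]) (simp add: scaleR_diff_left)

lemma coord_proj:
  assumes "schauder_basis e" "finite A"
  shows "coord e n (proj e A x) = (if n \<in> A then coord e n x else 0)"
  unfolding proj_def using coord_sum[OF assms] by simp

lemma proj_sum:
  assumes "schauder_basis e" "finite A" "B \<subseteq> A"
  shows "proj e B (\<Sum>i\<in>A. a i *\<^sub>R e i) = (\<Sum>i\<in>B. a i *\<^sub>R e i)"
  unfolding proj_def using assms(3) by (intro sum.cong) (auto simp: coord_sum[OF assms(1,2)])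

lemma quasi_greedyE:
  assumes "quasi_greedy e"
  obtains C where "0 \<le> C" "\<And>x L. greedy_set e x (card L) L \<Longrightarrow> norm (proj e L x) \<le> C * norm x"
proof -
  obtain C where C: "\<And>x m L. m \<ge> 1 \<Longrightarrow> greedy_set e x m L \<Longrightarrow> norm (proj e L x) \<le> C * norm x"
    using assms unfolding quasi_greedy_def by blast
  have "norm (proj e L x) \<le> \<bar>C\<bar> * norm x" if g: "greedy_set e x (card L) L" for x L
  proof (cases "L = {}")
    case False
    then have "norm (proj e L x) \<le> C * norm x"
      using g by (intro C[OF _ g]) (auto simp: greedy_set_def Suc_le_eq card_gt_0_iff)
    also have "\<dots> \<le> \<bar>C\<bar> * norm x" by (intro mult_right_mono) auto
    finally show ?thesis .
  qed (simp add: proj_def)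
  then show ?thesis using that[of "\<bar>C\<bar>"] by simp
qed

section \<open>Unconditionality-type estimates from quasi-greediness\<close>

context
  fixes e :: "nat \<Rightarrow> 'a::banach" and C :: real
  assumes basis: "schauder_basis e" and C_nonneg: "0 \<le> C"
    and greedy_bound: "\<And>x L. greedy_set e x (card L) L \<Longrightarrow> norm (proj e L x) \<le> C * norm x"
begin

text \<open>Coordinates of the sum vanish off \<open>L\<close>, so dominating the coefficients on
  \<open>L - B\<close> already makes \<open>B\<close> a greedy set.\<close>

lemma norm_greedy_subset_le:
  assumes "finite L" "B \<subseteq> L" "\<And>i j. i \<in> B \<Longrightarrow> j \<in> L - B \<Longrightarrow> \<bar>a j\<bar> \<le> \<bar>a i\<bar>"
  shows "norm (\<Sum>i\<in>B. a i *\<^sub>R e i) \<le> C * norm (\<Sum>i\<in>L. a i *\<^sub>R e i)"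
proof -
  have "greedy_set e (\<Sum>i\<in>L. a i *\<^sub>R e i) (card B) B"
    using assms by (auto simp: greedy_set_def coord_sum[OF basis] intro: finite_subset)
  from greedy_bound[OF this] show ?thesis
    by (simp add: proj_sum[OF basis assms(1,2)])
qed

text \<open>When all coefficients have modulus 1, every subset of \<open>L\<close> is greedy. Hence
  the parts with sign 1 and sign -1 are each bounded with constant \<open>C\<close>, and the second
  may be flipped.\<close>

lemma norm_ind_sum_le_signs:
  assumes L: "finite L" and s: "\<And>i. i \<in> L \<Longrightarrow> s i = 1 \<or> s i = - 1"
  shows "norm (ind_sum e L) \<le> 2 * C * norm (\<Sum>i\<in>L. s i *\<^sub>R e i)"
proof -
  define P where "P = {i\<in>L. s i = 1}"
  have P: "P \<subseteq> L" by (auto simp: P_def)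
  have abs: "\<bar>s j\<bar> = 1" if "j \<in> L" for j
    using s[OF that] by auto
  have 1: "norm (\<Sum>i\<in>P. s i *\<^sub>R e i) \<le> C * norm (\<Sum>i\<in>L. s i *\<^sub>R e i)"
    using P abs by (intro norm_greedy_subset_le L) auto
  have 2: "norm (\<Sum>i\<in>L-P. s i *\<^sub>R e i) \<le> C * norm (\<Sum>i\<in>L. s i *\<^sub>R e i)"
    using P abs by (intro norm_greedy_subset_le L) auto
  have "ind_sum e L = (\<Sum>i\<in>L-P. e i) + (\<Sum>i\<in>P. e i)"
    unfolding ind_sum_def by (rule sum.subset_diff[OF P L])
  also have "(\<Sum>i\<in>P. e i) = (\<Sum>i\<in>P. s i *\<^sub>R e i)"
    by (intro sum.cong) (auto simp: P_def)
  also have "(\<Sum>i\<in>L-P. e i) = - (\<Sum>i\<in>L-P. s i *\<^sub>R e i)"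
    unfolding sum_negf[symmetric] using s by (intro sum.cong) (force simp: P_def)+
  finally show ?thesis
    using norm_triangle_ineq4[of "\<Sum>i\<in>P. s i *\<^sub>R e i" "\<Sum>i\<in>L-P. s i *\<^sub>R e i"] 1 2 by simp
qed

text \<open>Shrinking each coefficient to modulus t multiplies it by t/|a_i|, which lies in [0,1].
  The superlevel sets of these factors are complements in \<open>L\<close> of greedy sets, which
  costs \<open>1 + C\<close> in the layer-cake bound.\<close>

lemma norm_sgn_sum_le:
  assumes L: "finite L" and t: "0 \<le> t" "\<And>i. i \<in> L \<Longrightarrow> t \<le> \<bar>a i\<bar>"
  shows "t * norm (\<Sum>i\<in>L. sgn (a i) *\<^sub>R e i) \<le> (1 + C) * norm (\<Sum>i\<in>L. a i *\<^sub>R e i)"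
proof -
  let ?z = "\<Sum>i\<in>L. a i *\<^sub>R e i"
  have "norm (\<Sum>i\<in>L. (t / \<bar>a i\<bar>) *\<^sub>R a i *\<^sub>R e i) \<le> 1 * ((1 + C) * norm ?z)"
  proof (rule norm_sum_scaleR_layer_le[OF L])
    \<comment> \<open>If \<open>a i = 0\<close> then t = 0, and the quotient is 0 by the convention
      for division by zero.\<close>
    show "0 \<le> t / \<bar>a i\<bar> \<and> t / \<bar>a i\<bar> \<le> 1" if "i \<in> L" for i
      using t(1) t(2)[OF that] by (auto simp: divide_le_eq)
    fix r :: real
    define B where "B = {i\<in>L. r \<le> t / \<bar>a i\<bar>}"
    have B: "B \<subseteq> L" by (auto simp: B_def)
    have "norm (\<Sum>i\<in>L-B. a i *\<^sub>R e i) \<le> C * norm ?z"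
    proof (rule norm_greedy_subset_le[OF L])
      \<comment> \<open>The quotient is below r at i and at least r at j. The strict inequality
        excludes t = 0, so the smaller quotient belongs to the larger modulus.\<close>
      fix i j assume i: "i \<in> L - B" and j: "j \<in> L - (L - B)"
      have "t / \<bar>a i\<bar> < t / \<bar>a j\<bar>" using i j by (auto simp: B_def)
      then show "\<bar>a j\<bar> \<le> \<bar>a i\<bar>"
        using t by (smt (verit) frac_le divide_eq_0_iff i DiffD1)
    qed auto
    moreover have "(\<Sum>i\<in>B. a i *\<^sub>R e i) = ?z - (\<Sum>i\<in>L-B. a i *\<^sub>R e i)"
      using sum.subset_diff[OF B L, of "\<lambda>i. a i *\<^sub>R e i"] by simp
    ultimately show "norm (\<Sum>i\<in>{i\<in>L. r \<le> t / \<bar>a i\<bar>}. a i *\<^sub>R e i) \<le> (1 + C) * norm ?z"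
      using norm_triangle_ineq4[of ?z "\<Sum>i\<in>L-B. a i *\<^sub>R e i"]
      unfolding B_def[symmetric] by (simp only: distrib_right mult_1)
  qed simp
  also have "(\<Sum>i\<in>L. (t / \<bar>a i\<bar>) *\<^sub>R a i *\<^sub>R e i) = t *\<^sub>R (\<Sum>i\<in>L. sgn (a i) *\<^sub>R e i)"
    unfolding scaleR_sum_right by (intro sum.cong) (auto simp: sgn_if)
  finally show ?thesis using t by simp
qed

text \<open>Pass from constant signs to the signs of the coefficients, at cost \<open>2 * C\<close>,
  and then to the coefficients themselves, at cost \<open>1 + C\<close>.\<close>

lemma norm_ind_sum_le:
  assumes L: "finite L" and t: "0 \<le> t" "\<And>i. i \<in> L \<Longrightarrow> t \<le> \<bar>a i\<bar>"
  shows "t * norm (ind_sum e L) \<le> 2 * C * (1 + C) * norm (\<Sum>i\<in>L. a i *\<^sub>R e i)"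
\<comment> \<open>For t = 0 some \<open>sgn (a i)\<close> may be 0, so the sign lemma is applied
  only for t > 0.\<close>
proof (cases "t = 0")
  case False
  then have "sgn (a i) = 1 \<or> sgn (a i) = - 1" if "i \<in> L" for i
    using t(1) t(2)[OF that] by (auto simp: sgn_if)
  then have "t * norm (ind_sum e L) \<le> t * (2 * C * norm (\<Sum>i\<in>L. sgn (a i) *\<^sub>R e i))"
    using t(1) L by (intro mult_left_mono norm_ind_sum_le_signs) auto
  also have "\<dots> = 2 * C * (t * norm (\<Sum>i\<in>L. sgn (a i) *\<^sub>R e i))" by simp
  also have "\<dots> \<le> 2 * C * ((1 + C) * norm (\<Sum>i\<in>L. a i *\<^sub>R e i))"
    using C_nonneg by (intro mult_left_mono norm_sgn_sum_le[OF L t]) auto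
  finally show ?thesis by (simp add: mult.assoc)
qed (use C_nonneg in simp)

section \<open>The estimate behind the converse implication\<close>

lemma norm_diff_proj_le:
  fixes w :: "nat \<Rightarrow> real"
  assumes w: "\<And>n. 0 < w n" and D: "1 \<le> D"
    and cons: "\<And>A B. finite A \<Longrightarrow> finite B \<Longrightarrow> set_less B A \<Longrightarrow> weight_of w A \<le> weight_of w B \<Longrightarrow>
        norm (ind_sum e A) \<le> D * norm (ind_sum e B)"
    and g: "greedy_set e x (card L) L" and "L \<noteq> {}"
    and A: "finite A" "weight_of w A \<le> weight_of w L" "set_less {Max L} A"
  shows "norm (x - proj e L x) \<le> (1 + C + 4 * D * C * C * (1 + C)) * norm (x - proj e A x)"
proof -
  define y where "y = x - proj e A x"
  define t where "t = (MIN i\<in>L. \<bar>coord e i x\<bar>)"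
  have L: "finite L" using g by (simp add: greedy_set_def)
  have less: "i < j" if "i \<in> L" "j \<in> A" for i j
    using A(3) Max_ge[OF L that(1)] that(2) unfolding set_less_def by fastforce
  have y: "coord e n y = (if n \<in> A then 0 else coord e n x)" for n
    by (simp add: y_def coord_diff[OF basis] coord_proj[OF basis A(1)])
  have notA: "i \<notin> A" if "i \<in> L" for i
    using less that by blast
  have gy: "greedy_set e y (card L) L"
    using g notA by (auto simp: greedy_set_def y)
  have yL: "proj e L y = proj e L x"
    unfolding proj_def by (intro sum.cong) (auto simp: y notA)
  have t_le: "t \<le> \<bar>coord e i x\<bar>" if "i \<in> L" for i
    unfolding t_def using L that by simp
  \<comment> \<open>The minimum is attained at some l in \<open>L\<close>, so greediness at l bounds
    every coordinate outside \<open>L\<close> by t.\<close>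
  have "t \<in> (\<lambda>i. \<bar>coord e i x\<bar>) ` L"
    unfolding t_def using L \<open>L \<noteq> {}\<close> by (intro Min_in) auto
  then obtain l where l: "l \<in> L" "t = \<bar>coord e l x\<bar>" by blast
  then have t0: "0 \<le> t" by simp
  have "norm (proj e A x) \<le> 2 * t * (D * norm (ind_sum e L))"
    unfolding proj_def
  proof (rule norm_sum_scaleR_subset_le[OF A(1) _ t0])
    show "\<bar>coord e i x\<bar> \<le> t" if "i \<in> A" for i
      using g l notA that unfolding greedy_set_def by blast
    fix B assume B: "B \<subseteq> A"
    \<comment> \<open>Conservativity is needed for all subsets of \<open>A\<close>; positivity of
      the weights passes the weight condition down to them.\<close>
    have "weight_of w B \<le> weight_of w A"
      unfolding weight_of_def using A(1) B w by (intro sum_mono2) (auto intro: less_imp_le)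
    then have "norm (ind_sum e B) \<le> D * norm (ind_sum e L)"
      using A B L less by (intro cons) (auto simp: set_less_def intro: finite_subset)
    then show "norm (sum e B) \<le> D * norm (ind_sum e L)" by (simp add: ind_sum_def)
  qed
  \<comment> \<open>The constant collects 2 from the sign splitting, \<open>D\<close> from
    conservativity, \<open>2 * C * (1 + C)\<close> from the indicator estimate, and a last
    \<open>C\<close> from projecting y onto its greedy set \<open>L\<close>.\<close>
  also have "\<dots> = 2 * D * (t * norm (ind_sum e L))" by simp
  also have "\<dots> \<le> 2 * D * (2 * C * (1 + C) * norm (proj e L x))"
    unfolding proj_def using D by (intro mult_left_mono norm_ind_sum_le L t0 t_le) auto
  also have "\<dots> \<le> 2 * D * (2 * C * (1 + C) * (C * norm y))"
    using greedy_bound[OF gy] D C_nonneg unfolding yL by (intro mult_left_mono) auto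
  finally have 1: "norm (proj e A x) \<le> 4 * D * C * C * (1 + C) * norm y"
    by (simp add: algebra_simps)
  have "x - proj e L x = y - proj e L y + proj e A x"
    by (simp add: yL) (simp add: y_def)
  then have "norm (x - proj e L x) \<le> norm y + norm (proj e L y) + norm (proj e A x)"
    by (metis norm_triangle_ineq norm_triangle_ineq4 add_mono_thms_linordered_semiring(3) order_trans)
  also have "\<dots> \<le> norm y + C * norm y + 4 * D * C * C * (1 + C) * norm y"
    by (intro add_mono 1 greedy_bound gy order_refl)
  also have "\<dots> = (1 + C + 4 * D * C * C * (1 + C)) * norm y" by (simp add: algebra_simps)
  finally show ?thesis unfolding y_def .
qed

end

section \<open>Replacing the infimum by a bound for each competitor\<close>

lemma weight_of_nonneg: "(\<And>n. 0 < w n) \<Longrightarrow> 0 \<le> weight_of w A"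
  unfolding weight_of_def by (simp add: sum_nonneg less_imp_le)

text \<open>A multiple of the infimum is a bound exactly when it is one for every admissible
  \<open>A\<close>. A positive constant allows division by it, which turns the bound into a lower
  bound of the family.\<close>

lemma reverse_partially_greedy_iff:
  assumes "\<And>n. w n > 0"
  shows "reverse_partially_greedy w e \<longleftrightarrow>
    (\<exists>K>0. \<forall>x L A. L \<noteq> {} \<longrightarrow> greedy_set e x (card L) L \<longrightarrow> finite A \<longrightarrow>
      weight_of w A \<le> weight_of w L \<longrightarrow> set_less {Max L} A \<longrightarrow>
      norm (x - proj e L x) \<le> K * norm (x - proj e A x))" (is "?L \<longleftrightarrow> ?R")
proof
  let ?S = "\<lambda>L. {A. finite A \<and> weight_of w A \<le> weight_of w L \<and> set_less {Max L} A}"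
  let ?f = "\<lambda>x A. norm (x - proj e A x)"
  have ne: "?S L \<noteq> {}" for L
  proof -
    have "{} \<in> ?S L"
      using weight_of_nonneg[of w L, OF assms] by (simp add: set_less_def) (simp add: weight_of_def)
    then show ?thesis by blast
  qed
  show ?R if ?L
  proof -
    obtain C where C: "\<And>x m L. m \<ge> 1 \<Longrightarrow> greedy_set e x m L \<Longrightarrow> ?f x L \<le> C * (INF A\<in>?S L. ?f x A)"
      using \<open>?L\<close> unfolding reverse_partially_greedy_def by blast
    have "?f x L \<le> (\<bar>C\<bar> + 1) * ?f x A"
      if "L \<noteq> {}" and g: "greedy_set e x (card L) L" and A: "A \<in> ?S L" for x L A
    proof -
      have "?f x L \<le> C * (INF A\<in>?S L. ?f x A)"
        using that by (intro C[OF _ g]) (auto simp: greedy_set_def Suc_le_eq card_gt_0_iff)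
      \<comment> \<open>Enlarging the constant is legitimate because an infimum of norms over a
        nonempty family is nonnegative.\<close>
      also have "\<dots> \<le> (\<bar>C\<bar> + 1) * (INF A\<in>?S L. ?f x A)"
        by (intro mult_right_mono cINF_greatest[OF ne]) auto
      also have "\<dots> \<le> (\<bar>C\<bar> + 1) * ?f x A"
        by (intro mult_left_mono cINF_lower[OF _ A] bdd_belowI2[of _ 0]) auto
      finally show ?thesis .
    qed
    then show ?R by (intro exI[of _ "\<bar>C\<bar> + 1"]) auto
  qed
  show ?L if ?R
  proof -
    obtain K where K0: "0 < K" and K: "\<And>x L A. L \<noteq> {} \<Longrightarrow> greedy_set e x (card L) L \<Longrightarrow> A \<in> ?S L \<Longrightarrow>
        ?f x L \<le> K * ?f x A"
      using \<open>?R\<close> by blast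
    have "?f x L \<le> K * (INF A\<in>?S L. ?f x A)" if "m \<ge> 1" "greedy_set e x m L" for x m L
    proof -
      have "?f x L / K \<le> (INF A\<in>?S L. ?f x A)"
      proof (rule cINF_greatest[OF ne])
        fix A assume "A \<in> ?S L"
        moreover have "L \<noteq> {}" "greedy_set e x (card L) L"
          using that by (auto simp: greedy_set_def)
        ultimately show "?f x L / K \<le> ?f x A"
          using K0 K[of L x A] by (simp add: divide_le_eq mult.commute)
      qed
      then show ?thesis using K0 by (simp add: divide_le_eq mult.commute)
    qed
    then show ?L unfolding reverse_partially_greedy_def by blast
  qed
qed

section \<open>The two implications\<close>

theorem theorem2p3:
  fixes e :: "nat \<Rightarrow> 'a::banach" and w :: "nat \<Rightarrow> real"
  assumes "schauder_basis e" and "normalized e" and "\<And>n. w n > 0"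
  shows "reverse_partially_greedy w e \<longleftrightarrow> quasi_greedy e \<and> reverse_conservative w e"
proof
  assume "reverse_partially_greedy w e"
  then obtain K where K0: "0 < K" and K: "\<And>x L A. L \<noteq> {} \<Longrightarrow> greedy_set e x (card L) L \<Longrightarrow>
      finite A \<Longrightarrow> weight_of w A \<le> weight_of w L \<Longrightarrow> set_less {Max L} A \<Longrightarrow>
      norm (x - proj e L x) \<le> K * norm (x - proj e A x)"
    unfolding reverse_partially_greedy_iff[OF assms(3)] by blast
  have "norm (proj e L x) \<le> (1 + K) * norm x" if "m \<ge> 1" "greedy_set e x m L" for x m L
  proof -
    have "norm (x - proj e L x) \<le> K * norm (x - proj e {} x)"
      using that weight_of_nonneg[of w L, OF assms(3)]
      by (intro K) (auto simp: greedy_set_def set_less_def weight_of_def)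
    then show ?thesis
      using norm_triangle_ineq4[of x "x - proj e L x"] by (simp add: proj_def algebra_simps)
  qed
  then have qg: "quasi_greedy e" unfolding quasi_greedy_def by blast
  have "norm (ind_sum e A) \<le> (1 + K) * norm (ind_sum e B)"
    if fin: "finite A" "finite B" and less: "set_less B A"
      and wt: "weight_of w A \<le> weight_of w B" for A B
  proof (cases "B = {}")
    case True
    \<comment> \<open>Positive weights leave no nonempty set of weight at most 0. This case stands
      apart because the greedy inequality requires a nonempty greedy set.\<close>
    then have "A = {}"
      using sum_pos[of A w] fin wt assms(3) by (force simp: weight_of_def)
    then show ?thesis using True by (simp add: ind_sum_def)
  next
    case False
    \<comment> \<open>All coordinates are 1 on \<open>A \<union> B\<close> and 0 elsewhere, so
      \<open>B\<close> is greedy for x; removing \<open>B\<close> leaves the indicator of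
      \<open>A\<close>, and removing \<open>A\<close> leaves that of \<open>B\<close>.\<close>
    define x where "x = (\<Sum>i\<in>A\<union>B. 1 *\<^sub>R e i)"
    have disj: "A \<inter> B = {}" using less by (auto simp: set_less_def)
    have x: "x = ind_sum e A + ind_sum e B"
      using fin disj by (simp add: x_def ind_sum_def sum.union_disjoint)
    have pr: "proj e E x = ind_sum e E" if "E \<subseteq> A \<union> B" for E
      unfolding x_def ind_sum_def using proj_sum[OF assms(1) _ that, of "\<lambda>_. 1"] fin by simp
    have "greedy_set e x (card B) B"
      using fin unfolding x_def greedy_set_def by (auto simp: coord_sum[OF assms(1)] simp del: scaleR_one)
    moreover have "set_less {Max B} A"
      using less fin False by (simp add: set_less_def)
    ultimately have "norm (x - proj e B x) \<le> K * norm (x - proj e A x)"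
      using False fin wt by (intro K)
    then have "norm (ind_sum e A) \<le> K * norm (ind_sum e B)" by (simp add: pr) (simp add: x)
    \<comment> \<open>The extra 1 secures a conservativity constant of at least 1.\<close>
    also have "\<dots> \<le> (1 + K) * norm (ind_sum e B)" by (intro mult_right_mono) auto
    finally show ?thesis .
  qed
  then have "reverse_conservative w e"
    unfolding reverse_conservative_def using K0 by (intro exI[of _ "1 + K"]) auto
  with qg show "quasi_greedy e \<and> reverse_conservative w e" ..
next
  assume "quasi_greedy e \<and> reverse_conservative w e"
  then have qg: "quasi_greedy e" and rc: "reverse_conservative w e" by auto
  obtain C where C: "0 \<le> C" "\<And>x L. greedy_set e x (card L) L \<Longrightarrow> norm (proj e L x) \<le> C * norm x"
    using quasi_greedyE[OF qg] by metis
  obtain D where D: "1 \<le> D" "\<And>A B. finite A \<Longrightarrow> finite B \<Longrightarrow> set_less B A \<Longrightarrow>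
      weight_of w A \<le> weight_of w B \<Longrightarrow> norm (ind_sum e A) \<le> D * norm (ind_sum e B)"
    using rc unfolding reverse_conservative_def by blast
  have "0 < 1 + C + 4 * D * C * C * (1 + C)"
    using C(1) D(1) by (intro add_pos_nonneg) auto
  then show "reverse_partially_greedy w e"
    unfolding reverse_partially_greedy_iff[OF assms(3)]
    by (intro exI[of _ "1 + C + 4 * D * C * C * (1 + C)"] conjI allI impI
        norm_diff_proj_le[where w = w] assms(1,3) C D)
qed

end
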